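(* Let $G$ be a finite group, let $\gamma=\{\gamma_j:\{1,2,\dots,k\}\to\mathbb{C}\}_{j=0,1,\dots,J}$ be a kernel and let $S$ be the associated $G$-scattering operator. For all $g\in G$, $p\in P_J$ and $f\in L^2(G)$, $$\text{(a)}\ \ S[p]L_gf=L_gS[p]f,\qquad\text{and}\qquad \text{(b)}\ \ S[p]R_gf=R_gS[p]f.$$
   Context: $G$ is a finite group (not necessarily abelian). $L^2(G)$ is the space of all functions $f:G\to\mathbb{C}$. For $g\in G$ and $f\in L^2(G)$, $L_gf(x)=f(g^{-1}x)$ and $R_gf(x)=f(xg)$, $x\in G$. Convolution is $f*h(x)=\frac{1}{|G|}\sum_{y\in G}f(y)h(y^{-1}x)$. $\pi^1,\dots,\pi^k$ is a complete system of pairwise inequivalent irreducible unitary representations of $G$, $d_r$ is the degree of $\pi^r$ and $\chi^r(x)=\mathrm{Tr}(\pi^r(x))$. Fix an integer $J\ge1$. A kernel is a family of functions $\gamma=\{\gamma_j:\{1,\dots,k\}\to\mathbb{C}\}_{0\le j\le J}$; its $G$-wavelets are $\psi_j(x)=\sum_{r=1}^k d_r\gamma_j(r)\chi^r(x)$, $0\le j\le J$, and we write $\phi=\psi_0$. For $m\ge1$, $\Lambda_J^m=\{1,\dots,J\}^m$ is the set of paths of length $m$; $\Lambda_J^0$ consists only of the empty path $\emptyset$; $P_J=\bigcup_{m\ge0}\Lambda_J^m$. For $f\in L^2(G)$, $U[\emptyset]f=f$, $U[j]f=|\psi_j*f|$ (pointwise modulus) for $1\le j\le J$, and $U[p]f=U[j_m]\cdots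 U[j_1]f$ for $p=(j_1,\dots,j_m)\in\Lambda_J^m$. For $p\in P_J$, $S[p]f=\phi*U[p]f$. *)

theory Defs
  imports
    "HOL-Algebra.Group"
    "HOL-Library.FuncSet"
    "Jordan_Normal_Form.VS_Connect"
    "Jordan_Normal_Form.Schur_Decomposition"
begin

section \<open>Unitary matrix representations\<close>

definition unitary_group :: "nat \<Rightarrow> complex mat monoid" where
  "unitary_group n =
     \<lparr>carrier = {U \<in> carrier_mat n n. U * mat_adjoint U = 1\<^sub>m n \<and> mat_adjoint U * U = 1\<^sub>m n},
      monoid.mult = (*), one = 1\<^sub>m n\<rparr>"

definition unitary_rep :: "('a, 'b) monoid_scheme \<Rightarrow> nat \<Rightarrow> ('a \<Rightarrow> complex mat) \<Rightarrow> bool" where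
  "unitary_rep G n \<rho> \<longleftrightarrow> \<rho> \<in> hom G (unitary_group n)"

definition irreducible_unitary_rep ::
    "('a, 'b) monoid_scheme \<Rightarrow> nat \<Rightarrow> ('a \<Rightarrow> complex mat) \<Rightarrow> bool" where
  "irreducible_unitary_rep G n \<rho> \<longleftrightarrow>
     unitary_rep G n \<rho> \<and> n \<ge> 1 \<and>
     (\<forall>W. VectorSpace.subspace class_ring W (module_vec TYPE(complex) n) \<and>
          (\<forall>x\<in>carrier G. \<forall>w\<in>W. \<rho> x *\<^sub>v w \<in> W) \<longrightarrow>
          W = {0\<^sub>v n} \<or> W = carrier_vec n)"

definition equivalent_reps ::
    "('a, 'b) monoid_scheme \<Rightarrow> nat \<Rightarrow> ('a \<Rightarrow> complex mat) \<Rightarrow> nat \<Rightarrow> ('a \<Rightarrow> complex mat) \<Rightarrow> bool" where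
  "equivalent_reps G n \<rho> m \<sigma> \<longleftrightarrow>
     n = m \<and>
     (\<exists>T\<in>carrier_mat n n. invertible_mat T \<and> (\<forall>x\<in>carrier G. T * \<rho> x = \<sigma> x * T))"

definition complete_irreducible_system ::
    "('a, 'b) monoid_scheme \<Rightarrow> nat \<Rightarrow> (nat \<Rightarrow> nat) \<Rightarrow> (nat \<Rightarrow> 'a \<Rightarrow> complex mat) \<Rightarrow> bool" where
  "complete_irreducible_system G k d \<pi> \<longleftrightarrow>
     (\<forall>r\<in>{1..k}. irreducible_unitary_rep G (d r) (\<pi> r)) \<and>
     (\<forall>r\<in>{1..k}. \<forall>s\<in>{1..k}. r \<noteq> s \<longrightarrow> \<not> equivalent_reps G (d r) (\<pi> r) (d s) (\<pi> s)) \<and>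
     (\<forall>n \<rho>. irreducible_unitary_rep G n \<rho> \<longrightarrow>
        (\<exists>r\<in>{1..k}. equivalent_reps G n \<rho> (d r) (\<pi> r)))"

definition mat_trace :: "complex mat \<Rightarrow> complex" where
  "mat_trace A = (\<Sum>i<dim_row A. A $$ (i, i))"

definition rep_character :: "(nat \<Rightarrow> 'a \<Rightarrow> complex mat) \<Rightarrow> nat \<Rightarrow> 'a \<Rightarrow> complex" where
  "rep_character \<pi> r x = mat_trace (\<pi> r x)"


section \<open>Functions on a finite group\<close>

text \<open>A function on the group is an extensional function on \<open>carrier G\<close>, so that equality in
  \<open>L2 G\<close> is pointwise equality on the group; every operator below returns such a function.\<close>

definition L2 :: "('a, 'b) monoid_scheme \<Rightarrow> ('a \<Rightarrow> complex) set" where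
  "L2 G = carrier G \<rightarrow>\<^sub>E UNIV"

definition left_translate ::
    "('a, 'b) monoid_scheme \<Rightarrow> 'a \<Rightarrow> ('a \<Rightarrow> complex) \<Rightarrow> 'a \<Rightarrow> complex" where
  "left_translate G g f = (\<lambda>x\<in>carrier G. f (inv\<^bsub>G\<^esub> g \<otimes>\<^bsub>G\<^esub> x))"

definition right_translate ::
    "('a, 'b) monoid_scheme \<Rightarrow> 'a \<Rightarrow> ('a \<Rightarrow> complex) \<Rightarrow> 'a \<Rightarrow> complex" where
  "right_translate G g f = (\<lambda>x\<in>carrier G. f (x \<otimes>\<^bsub>G\<^esub> g))"

definition convolution ::
    "('a, 'b) monoid_scheme \<Rightarrow> ('a \<Rightarrow> complex) \<Rightarrow> ('a \<Rightarrow> complex) \<Rightarrow> 'a \<Rightarrow> complex" where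
  "convolution G f h =
     (\<lambda>x\<in>carrier G. 1 / of_nat (card (carrier G)) *
        (\<Sum>y\<in>carrier G. f y * h (inv\<^bsub>G\<^esub> y \<otimes>\<^bsub>G\<^esub> x)))"

definition modulus ::
    "('a, 'b) monoid_scheme \<Rightarrow> ('a \<Rightarrow> complex) \<Rightarrow> 'a \<Rightarrow> complex" where
  "modulus G f = (\<lambda>x\<in>carrier G. complex_of_real (cmod (f x)))"


section \<open>Wavelets and scattering\<close>

text \<open>A kernel is given by \<open>\<gamma> j r\<close>; only its values for \<open>j \<le> J\<close> and \<open>1 \<le> r \<le> k\<close> matter.\<close>

definition wavelet ::
    "('a, 'b) monoid_scheme \<Rightarrow> nat \<Rightarrow> (nat \<Rightarrow> nat) \<Rightarrow> (nat \<Rightarrow> 'a \<Rightarrow> complex mat) \<Rightarrow>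
     (nat \<Rightarrow> nat \<Rightarrow> complex) \<Rightarrow> nat \<Rightarrow> 'a \<Rightarrow> complex" where
  "wavelet G k d \<pi> \<gamma> j =
     (\<lambda>x\<in>carrier G. \<Sum>r=1..k. of_nat (d r) * \<gamma> j r * rep_character \<pi> r x)"

definition paths_of_length :: "nat \<Rightarrow> nat \<Rightarrow> nat list set" where
  "paths_of_length J m = {p. length p = m \<and> set p \<subseteq> {1..J}}"

definition paths :: "nat \<Rightarrow> nat list set" where
  "paths J = (\<Union>m. paths_of_length J m)"

text \<open>The head of the list is applied first: \<open>U[(j\<^sub>1, \<dots>, j\<^sub>m)] = U[j\<^sub>m] \<dots> U[j\<^sub>1]\<close>.\<close>

fun propagator ::
    "('a, 'b) monoid_scheme \<Rightarrow> (nat \<Rightarrow> 'a \<Rightarrow> complex) \<Rightarrow> nat list \<Rightarrow>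
     ('a \<Rightarrow> complex) \<Rightarrow> 'a \<Rightarrow> complex" where
  "propagator G \<psi> [] f = f"
| "propagator G \<psi> (j # p) f = propagator G \<psi> p (modulus G (convolution G (\<psi> j) f))"

definition scattering ::
    "('a, 'b) monoid_scheme \<Rightarrow> (nat \<Rightarrow> 'a \<Rightarrow> complex) \<Rightarrow> nat list \<Rightarrow>
     ('a \<Rightarrow> complex) \<Rightarrow> 'a \<Rightarrow> complex" where
  "scattering G \<psi> p f = convolution G (\<psi> 0) (propagator G \<psi> p f)"

end

theory Submission
  imports Defs
begin

text \<open>Convolution \<open>h * f\<close> from the left by any \<open>h\<close> commutes with right translations of \<open>f\<close>. It
  commutes with left translations as soon as \<open>h\<close> is a class function, because the substitution
  \<open>y = g z g\<inverse>\<close> in \<open>\<Sum>y. h(y) f(g\<inverse> y\<inverse> x)\<close> yields \<open>\<Sum>z. h(g z g\<inverse>) f(z\<inverse> g\<inverse> x)\<close>. The wavelets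
  are linear combinations of characters and hence class functions
  (\<open>class_function_wavelet\<close>). Since the pointwise modulus commutes with all translations, so do
  \<open>U[p]\<close>, by induction on the path, and \<open>S[p]\<close>.\<close>

text \<open>Class functions, in the form \<open>h (x y) = h (y x)\<close>, which over a group is equivalent to
  invariance under conjugation.\<close>

definition class_function :: "('a, 'b) monoid_scheme \<Rightarrow> ('a \<Rightarrow> complex) \<Rightarrow> bool" where
  "class_function G h \<longleftrightarrow>
     (\<forall>x\<in>carrier G. \<forall>y\<in>carrier G. h (x \<otimes>\<^bsub>G\<^esub> y) = h (y \<otimes>\<^bsub>G\<^esub> x))"

lemma mat_trace_mult_commute:
  assumes A: "A \<in> carrier_mat n m" and B: "B \<in> carrier_mat m n"
  shows "mat_trace (A * B) = mat_trace (B * A)"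
proof -
  have "mat_trace (A * B) = (\<Sum>i<n. \<Sum>j<m. A $$ (i, j) * B $$ (j, i))"
    using A B by (auto simp: mat_trace_def scalar_prod_def lessThan_atLeast0 intro!: sum.cong)
  also have "\<dots> = (\<Sum>j<m. \<Sum>i<n. B $$ (j, i) * A $$ (i, j))"
    by (subst sum.swap) (simp add: mult.commute)
  also have "\<dots> = mat_trace (B * A)"
    using A B by (auto simp: mat_trace_def scalar_prod_def lessThan_atLeast0 intro!: sum.cong)
  finally show ?thesis .
qed

lemma class_function_rep_character:
  assumes "unitary_rep G n (\<pi> r)"
  shows "class_function G (rep_character \<pi> r)"
  unfolding class_function_def
proof (intro ballI)
  fix x y assume xy: "x \<in> carrier G" "y \<in> carrier G"
  have hom: "\<pi> r \<in> hom G (unitary_group n)"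
    using assms by (simp add: unitary_rep_def)
  have "\<pi> r x \<in> carrier_mat n n" "\<pi> r y \<in> carrier_mat n n"
    using hom_in_carrier[OF hom] xy by (auto simp: unitary_group_def)
  then show "rep_character \<pi> r (x \<otimes>\<^bsub>G\<^esub> y) = rep_character \<pi> r (y \<otimes>\<^bsub>G\<^esub> x)"
    using hom_mult[OF hom] xy
    by (simp add: rep_character_def unitary_group_def mat_trace_mult_commute[of _ n n])
qed

lemma class_function_wavelet:
  assumes "group G" and "\<And>r. r \<in> {1..k} \<Longrightarrow> unitary_rep G (d r) (\<pi> r)"
  shows "class_function G (wavelet G k d \<pi> \<gamma> j)"
proof -
  interpret group G by fact
  have "rep_character \<pi> r (x \<otimes>\<^bsub>G\<^esub> y) = rep_character \<pi> r (y \<otimes>\<^bsub>G\<^esub> x)"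
    if "r \<in> {1..k}" "x \<in> carrier G" "y \<in> carrier G" for r x y
    using class_function_rep_character[of G "d r" \<pi> r] assms(2) that
    by (auto simp: class_function_def)
  then show ?thesis
    by (auto simp: class_function_def wavelet_def intro!: sum.cong)
qed

context group
begin

lemma convolution_right_translate:
  assumes "g \<in> carrier G"
  shows "convolution G h (right_translate G g f) = right_translate G g (convolution G h f)"
  using assms
  by (auto simp: convolution_def right_translate_def m_assoc
      intro!: restrict_ext sum.cong)

lemma convolution_left_translate:
  assumes h: "class_function G h" and g: "g \<in> carrier G"
  shows "convolution G h (left_translate G g f) = left_translate G g (convolution G h f)"
proof -
  have cancel: "a \<otimes> (inv a \<otimes> b) = b" "inv a \<otimes> (a \<otimes> b) = b"
    if "a \<in> carrier G" "b \<in> carrier G" for a b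
    using that by (simp_all add: m_assoc[symmetric])
  have "(\<Sum>y\<in>carrier G. h y * left_translate G g f (inv y \<otimes> x)) =
        (\<Sum>z\<in>carrier G. h z * f (inv z \<otimes> (inv g \<otimes> x)))" if x: "x \<in> carrier G" for x
  proof (rule sum.reindex_bij_witness[where i = "\<lambda>z. g \<otimes> z \<otimes> inv g" and j = "\<lambda>y. inv g \<otimes> y \<otimes> g"])
    fix y assume y: "y \<in> carrier G"
    show "g \<otimes> (inv g \<otimes> y \<otimes> g) \<otimes> inv g = y"
      using g y by (simp add: m_assoc cancel)
    have "h (inv g \<otimes> y \<otimes> g) = h (g \<otimes> (inv g \<otimes> y))"
      using h g y by (simp add: class_function_def)
    also have "\<dots> = h y"
      using g y by (simp add: m_assoc[symmetric])
    finally have "h (inv g \<otimes> y \<otimes> g) = h y" .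
    moreover have "inv (inv g \<otimes> y \<otimes> g) \<otimes> (inv g \<otimes> x) = inv g \<otimes> (inv y \<otimes> x)"
      using g x y by (simp add: inv_mult_group m_assoc cancel)
    ultimately show "h (inv g \<otimes> y \<otimes> g) * f (inv (inv g \<otimes> y \<otimes> g) \<otimes> (inv g \<otimes> x)) =
        h y * left_translate G g f (inv y \<otimes> x)"
      using x y by (simp add: left_translate_def)
  qed (use g in \<open>auto simp: m_assoc cancel\<close>)
  then show ?thesis
    using g by (auto simp: convolution_def left_translate_def[of G g "restrict _ _"]
        intro!: restrict_ext)
qed

lemma modulus_right_translate:
  "g \<in> carrier G \<Longrightarrow> modulus G (right_translate G g f) = right_translate G g (modulus G f)"
  by (auto simp: modulus_def right_translate_def intro!: restrict_ext)

lemma modulus_left_translate: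
  "g \<in> carrier G \<Longrightarrow> modulus G (left_translate G g f) = left_translate G g (modulus G f)"
  by (auto simp: modulus_def left_translate_def intro!: restrict_ext)

lemma propagator_right_translate:
  assumes "g \<in> carrier G"
  shows "propagator G \<psi> p (right_translate G g f) = right_translate G g (propagator G \<psi> p f)"
  using assms
  by (induction p arbitrary: f) (simp_all add: convolution_right_translate modulus_right_translate)

lemma propagator_left_translate:
  assumes "\<And>j. class_function G (\<psi> j)" and "g \<in> carrier G"
  shows "propagator G \<psi> p (left_translate G g f) = left_translate G g (propagator G \<psi> p f)"
  using assms
  by (induction p arbitrary: f) (simp_all add: convolution_left_translate modulus_left_translate)

end

theorem proposition4p7:
  fixes G :: "('a, 'b) monoid_scheme"
    and k J :: nat
    and d :: "nat \<Rightarrow> nat"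
    and \<pi> :: "nat \<Rightarrow> 'a \<Rightarrow> complex mat"
    and \<gamma> :: "nat \<Rightarrow> nat \<Rightarrow> complex"
    and g :: 'a
    and p :: "nat list"
    and f :: "'a \<Rightarrow> complex"
  assumes "group G" and "finite (carrier G)"
    and "complete_irreducible_system G k d \<pi>"
    and "J \<ge> 1"
    and "g \<in> carrier G" and "p \<in> paths J" and "f \<in> L2 G"
  shows "scattering G (wavelet G k d \<pi> \<gamma>) p (left_translate G g f) =
           left_translate G g (scattering G (wavelet G k d \<pi> \<gamma>) p f) \<and>
         scattering G (wavelet G k d \<pi> \<gamma>) p (right_translate G g f) =
           right_translate G g (scattering G (wavelet G k d \<pi> \<gamma>) p f)"
proof -
  interpret group G by fact
  have "class_function G (wavelet G k d \<pi> \<gamma> j)" for j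
    using assms(1,3)
    by (intro class_function_wavelet)
      (auto simp: complete_irreducible_system_def irreducible_unitary_rep_def)
  then show ?thesis
    using \<open>g \<in> carrier G\<close>
    by (simp add: scattering_def propagator_left_translate convolution_left_translate
        propagator_right_translate convolution_right_translate)
qed

end
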